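(* Let $n\geq 3$ and $2\leq k\leq\binom{n}{2}$, and let $p,q,r$ be the integers with $k\binom{p}{2}\leq\binom{n}{2}<k\binom{p+1}{2}$, $\binom{n}{2}=k\binom{p}{2}+qp+r$, $0\leq q<k$, $0\leq r<p$. Suppose $M(k,n)$ is attained by a packing of Type 1 or Type 2, where in the case of Type 2 with $r\geq(p-1)/2$ the non-complete member $G\in\mathcal{F}_{p,r}$ of the packing satisfies $\omega(G)=p$. Then $$\omega(k,n)=\chi(k,n)=\mathrm{ch}(k,n)=\mathrm{col}(k,n)=\lfloor M(k,n)\rfloor+k$$ and $$\kappa^*(k,n)=\lambda^*(k,n)=\delta^*(k,n)=\lfloor M(k,n)\rfloor.$$
   Context: For a finite graph $G$, $\mathrm{Mad}(G)=\max\{2e(H)/|V(H)| : H\subseteq G,\ |V(H)|\geq 1\}$. For a graph parameter $\mathfrak{p}$, $\mathfrak{p}(k,n)$ is the maximum of $\sum_{i=1}^k\mathfrak{p}(G_i)$ over all partitions of $E(K_n)$ into $k$ spanning subgraphs $G_1,\dots,G_k$; $M(k,n)$ is this for $\mathfrak{p}=\mathrm{Mad}$. Parameters: $\omega$ clique number; $\chi$ chromatic number; $\mathrm{ch}$ choice (list chromatic) number; $\delta^*(G)$ degeneracy, i.e. $\max\delta(H)$ over induced subgraphs $H$; $\mathrm{col}(G)=\delta^*(G)+1$; $\kappa^*(G)$ (resp. $\lambda^*(G)$) the maximum vertex (resp. edge) connectivity of an induced subgraph of $G$. For $0<r<p$ and $m=\binom{p}{2}+r$, $\mathcal{F}_{p,r}$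 is: the graphs with $m$ edges containing $K_p$, if $r<(p-1)/2$; the graphs with $m$ edges containing $K_p$ or having exactly $p+1$ vertices, if $r=(p-1)/2$; the graphs with $m$ edges and exactly $p+1$ vertices, if $r>(p-1)/2$. "$M(k,n)$ is attained by a packing of Type 1" means ($r=0$ and) $K_n$ has an edge decomposition, ignoring isolated vertices, into $q$ copies of $K_{p+1}$ and $k-q$ copies of $K_p$, whose $\mathrm{Mad}$ values sum to $M(k,n)$; "Type 2" means ($0<r<p$ and) $K_n$ has an edge decomposition into $q$ copies of $K_{p+1}$, $k-q-1$ copies of $K_p$ and one graph $G\in\mathcal{F}_{p,r}$, whose $\mathrm{Mad}$ values sum to $M(k,n)$. *)

theory Defs
  imports Complex_Main "HOL-Library.Disjoint_Sets"
begin

type_synonym 'a graph = "'a set \<times> 'a set set"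

abbreviation verts :: "'a graph \<Rightarrow> 'a set" where
  "verts \<equiv> fst"

abbreviation edges :: "'a graph \<Rightarrow> 'a set set" where
  "edges \<equiv> snd"

definition pairs :: "'a set \<Rightarrow> 'a set set" where
  "pairs S = {e. e \<subseteq> S \<and> card e = 2}"

definition fin_graph :: "'a graph \<Rightarrow> bool" where
  "fin_graph G \<longleftrightarrow> finite (verts G) \<and> edges G \<subseteq> pairs (verts G)"

definition complete_graph :: "nat \<Rightarrow> nat graph" where
  "complete_graph n = ({..<n}, pairs {..<n})"

definition subgraph :: "'a graph \<Rightarrow> 'a graph \<Rightarrow> bool" where
  "subgraph H G \<longleftrightarrow> fin_graph H \<and> verts H \<subseteq> verts G \<and> edges H \<subseteq> edges G"

definition induced :: "'a graph \<Rightarrow> 'a set \<Rightarrow> 'a graph" where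
  "induced G S = (S, {e \<in> edges G. e \<subseteq> S})"

definition drop_isolated :: "'a graph \<Rightarrow> 'a graph" where
  "drop_isolated G = ({v \<in> verts G. \<exists>e \<in> edges G. v \<in> e}, edges G)"

definition connected_graph :: "'a graph \<Rightarrow> bool" where
  "connected_graph G \<longleftrightarrow>
     (\<forall>u \<in> verts G. \<forall>v \<in> verts G. (\<lambda>x y. {x, y} \<in> edges G)\<^sup>*\<^sup>* u v)"


definition Mad :: "'a graph \<Rightarrow> real" where
  "Mad G = Max {2 * real (card (edges H)) / real (card (verts H)) | H.
                  subgraph H G \<and> card (verts H) \<ge> 1}"

definition is_clique :: "'a graph \<Rightarrow> 'a set \<Rightarrow> bool" where
  "is_clique G S \<longleftrightarrow> S \<subseteq> verts G \<and> pairs S \<subseteq> edges G"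

definition clique_number :: "'a graph \<Rightarrow> nat" where
  "clique_number G = Max {card S | S. is_clique G S}"

definition proper_coloring :: "'a graph \<Rightarrow> ('a \<Rightarrow> nat) \<Rightarrow> bool" where
  "proper_coloring G f \<longleftrightarrow>
     (\<forall>u \<in> verts G. \<forall>v \<in> verts G. u \<noteq> v \<and> {u, v} \<in> edges G \<longrightarrow> f u \<noteq> f v)"

definition chromatic_number :: "'a graph \<Rightarrow> nat" where
  "chromatic_number G = (LEAST c. \<exists>f. proper_coloring G f \<and> (\<forall>v \<in> verts G. f v < c))"

definition choosable :: "'a graph \<Rightarrow> nat \<Rightarrow> bool" where
  "choosable G c \<longleftrightarrow>
     (\<forall>L :: 'a \<Rightarrow> nat set. (\<forall>v \<in> verts G. finite (L v) \<and> card (L v) = c) \<longrightarrow>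
        (\<exists>f. proper_coloring G f \<and> (\<forall>v \<in> verts G. f v \<in> L v)))"

definition choice_number :: "'a graph \<Rightarrow> nat" where
  "choice_number G = (LEAST c. choosable G c)"

definition vdegree :: "'a graph \<Rightarrow> 'a \<Rightarrow> nat" where
  "vdegree G v = card {e \<in> edges G. v \<in> e}"

definition min_degree :: "'a graph \<Rightarrow> nat" where
  "min_degree G = Min (vdegree G ` verts G)"

text \<open>
  Vertex connectivity is the least number of vertices whose deletion leaves a disconnected
  graph or a single vertex, so a complete graph on \<open>m\<close> vertices has connectivity \<open>m - 1\<close>.
  Both connectivities of a one-vertex graph are 0.
\<close>

definition vertex_connectivity :: "'a graph \<Rightarrow> nat" where
  "vertex_connectivity G =
     Min {card X | X. X \<subset> verts G \<and>
            (\<not> connected_graph (induced G (verts G - X)) \<or> card (verts G - X) = 1)}"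

definition edge_connectivity :: "'a graph \<Rightarrow> nat" where
  "edge_connectivity G =
     (if card (verts G) \<le> 1 then 0
      else Min {card F | F. F \<subseteq> edges G \<and> \<not> connected_graph (verts G, edges G - F)})"

definition max_induced :: "('a graph \<Rightarrow> nat) \<Rightarrow> 'a graph \<Rightarrow> nat" where
  "max_induced f G = Max {f (induced G S) | S. S \<subseteq> verts G \<and> S \<noteq> {}}"

definition degeneracy :: "'a graph \<Rightarrow> nat" where
  "degeneracy = max_induced min_degree"

definition coloring_number :: "'a graph \<Rightarrow> nat" where
  "coloring_number G = degeneracy G + 1"

definition kappa_star :: "'a graph \<Rightarrow> nat" where
  "kappa_star = max_induced vertex_connectivity"

definition lambda_star :: "'a graph \<Rightarrow> nat" where
  "lambda_star = max_induced edge_connectivity"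


definition edge_partition :: "nat \<Rightarrow> nat \<Rightarrow> (nat \<Rightarrow> nat graph) \<Rightarrow> bool" where
  "edge_partition k n G \<longleftrightarrow>
     (\<forall>i<k. verts (G i) = {..<n}) \<and>
     disjoint_family_on (\<lambda>i. edges (G i)) {..<k} \<and>
     (\<Union>i<k. edges (G i)) = edges (complete_graph n)"

definition param_max ::
  "(nat graph \<Rightarrow> 'b::{linorder,comm_monoid_add}) \<Rightarrow> nat \<Rightarrow> nat \<Rightarrow> 'b" where
  "param_max f k n = Max {(\<Sum>i<k. f (G i)) | G. edge_partition k n G}"


definition copy_of_complete :: "nat \<Rightarrow> 'a graph \<Rightarrow> bool" where
  "copy_of_complete m G \<longleftrightarrow> finite (verts G) \<and> card (verts G) = m \<and> edges G = pairs (verts G)"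

definition contains_complete :: "nat \<Rightarrow> 'a graph \<Rightarrow> bool" where
  "contains_complete m G \<longleftrightarrow> (\<exists>H. subgraph H G \<and> copy_of_complete m H)"

definition F_family :: "nat \<Rightarrow> nat \<Rightarrow> 'a graph set" where
  "F_family p r =
     {G. fin_graph G \<and> card (edges G) = (p choose 2) + r \<and>
         (if real r < (real p - 1) / 2 then contains_complete p G
          else if real r = (real p - 1) / 2 then contains_complete p G \<or> card (verts G) = p + 1
          else card (verts G) = p + 1)}"

definition type1_packing ::
  "nat \<Rightarrow> nat \<Rightarrow> nat \<Rightarrow> nat \<Rightarrow> nat \<Rightarrow> (nat \<Rightarrow> nat graph) \<Rightarrow> bool" where
  "type1_packing k n p q r G \<longleftrightarrow>
     r = 0 \<and> edge_partition k n G \<and>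
     (\<exists>Q \<subseteq> {..<k}. card Q = q \<and>
        (\<forall>i \<in> Q. copy_of_complete (p + 1) (drop_isolated (G i))) \<and>
        (\<forall>i \<in> {..<k} - Q. copy_of_complete p (drop_isolated (G i))))"

text \<open>The index \<open>j\<close> marks the member of the packing that comes from \<open>F_family p r\<close>.\<close>

definition type2_packing ::
  "nat \<Rightarrow> nat \<Rightarrow> nat \<Rightarrow> nat \<Rightarrow> nat \<Rightarrow> (nat \<Rightarrow> nat graph) \<Rightarrow> nat \<Rightarrow> bool" where
  "type2_packing k n p q r G j \<longleftrightarrow>
     0 < r \<and> r < p \<and> edge_partition k n G \<and> j < k \<and>
     drop_isolated (G j) \<in> F_family p r \<and>
     (\<exists>Q \<subseteq> {..<k} - {j}. card Q = q \<and>
        (\<forall>i \<in> Q. copy_of_complete (p + 1) (drop_isolated (G i))) \<and>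
        (\<forall>i \<in> {..<k} - {j} - Q. copy_of_complete p (drop_isolated (G i))))"

end

theory Submission
  imports Defs
begin

text \<open>
  Every graph with at least one vertex satisfies \<open>\<omega> - 1 \<le> \<kappa>* \<le> \<delta>* \<le> Mad\<close>,
  \<open>\<omega> - 1 \<le> \<lambda>* \<le> \<delta>*\<close> and \<open>\<omega> \<le> \<chi> \<le> ch \<le> \<delta>* + 1\<close>. Hence over any partition the
  values of \<open>\<kappa>*\<close>, \<open>\<lambda>*\<close>, \<open>\<delta>*\<close>, and of the other parameters minus 1, sum to at most \<open>\<lfloor>M(k,n)\<rfloor>\<close>.
  In the given packing every complete member has \<open>Mad = \<omega> - 1\<close>, while the exceptional member
  has fewer than \<open>(p + 1 choose 2)\<close> edges, so \<open>Mad < p \<le> \<omega>\<close>. Thus the sum of \<open>\<omega> - 1\<close> over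
  the packing exceeds \<open>M(k,n) - 1\<close>, and all the bounds are attained by this one packing.
\<close>

section \<open>Finite graphs\<close>

lemma finite_pairs: "finite S \<Longrightarrow> finite (pairs S)"
  by (simp add: pairs_def)

lemma card_pairs: "finite S \<Longrightarrow> card (pairs S) = card S choose 2"
  unfolding pairs_def by (rule n_subsets)

lemma doubleton_in_pairs [simp]: "{u, v} \<in> pairs S \<longleftrightarrow> u \<in> S \<and> v \<in> S \<and> u \<noteq> v"
  by (auto simp: pairs_def card_insert_if)

lemma fin_graph_complete: "finite S \<Longrightarrow> fin_graph (S, pairs S)"
  by (simp add: fin_graph_def)

lemma fin_graph_finite_verts: "fin_graph G \<Longrightarrow> finite (verts G)"
  by (simp add: fin_graph_def)

lemma fin_graph_finite_edges: "fin_graph G \<Longrightarrow> finite (edges G)"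
  unfolding fin_graph_def using finite_pairs finite_subset by blast

lemma fin_graph_card_verts_pos: "fin_graph G \<Longrightarrow> verts G \<noteq> {} \<Longrightarrow> 0 < card (verts G)"
  by (simp add: fin_graph_finite_verts card_gt_0_iff)

lemma fin_graph_card_edges_le: "fin_graph G \<Longrightarrow> card (edges G) \<le> card (verts G) choose 2"
  unfolding fin_graph_def using card_mono[OF finite_pairs] card_pairs by metis

lemma subgraph_refl: "fin_graph G \<Longrightarrow> subgraph G G"
  by (simp add: subgraph_def)

lemma finite_subgraphs:
  assumes "fin_graph G"
  shows "finite {H. subgraph H G}"
proof (rule finite_subset)
  show "{H. subgraph H G} \<subseteq> Pow (verts G) \<times> Pow (edges G)"
    by (auto simp: subgraph_def)
  show "finite (Pow (verts G) \<times> Pow (edges G))"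
    using assms by (simp add: fin_graph_finite_verts fin_graph_finite_edges)
qed

lemma verts_induced [simp]: "verts (induced G S) = S"
  by (simp add: induced_def)

lemma induced_induced: "T \<subseteq> S \<Longrightarrow> induced (induced G S) T = induced G T"
  by (auto simp: induced_def)

lemma induced_verts: "fin_graph G \<Longrightarrow> induced G (verts G) = G"
  by (cases G) (auto simp: induced_def fin_graph_def pairs_def)

lemma subgraph_induced: "fin_graph G \<Longrightarrow> S \<subseteq> verts G \<Longrightarrow> subgraph (induced G S) G"
  using finite_subset unfolding subgraph_def fin_graph_def induced_def pairs_def by fastforce

lemma fin_graph_induced: "fin_graph G \<Longrightarrow> S \<subseteq> verts G \<Longrightarrow> fin_graph (induced G S)"
  using subgraph_induced unfolding subgraph_def by blast

lemma subgraph_drop_isolated: "fin_graph G \<Longrightarrow> subgraph (drop_isolated G) G"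
  by (auto simp: subgraph_def fin_graph_def drop_isolated_def pairs_def)

lemma edges_drop_isolated [simp]: "edges (drop_isolated G) = edges G"
  by (simp add: drop_isolated_def)

section \<open>Degrees\<close>

definition neighbors :: "'a graph \<Rightarrow> 'a \<Rightarrow> 'a set" where
  "neighbors G v = {u. {u, v} \<in> edges G}"

lemma neighbors_subset:
  assumes "fin_graph G"
  shows "neighbors G v \<subseteq> verts G - {v}"
proof
  fix u assume "u \<in> neighbors G v"
  then have "{u, v} \<in> pairs (verts G)"
    using assms unfolding neighbors_def fin_graph_def by blast
  then show "u \<in> verts G - {v}"
    by simp
qed

lemma finite_neighbors: "fin_graph G \<Longrightarrow> finite (neighbors G v)"
  using neighbors_subset fin_graph_finite_verts by (metis finite_Diff finite_subset)

lemma neighbors_induced: "v \<in> S \<Longrightarrow> neighbors (induced G S) v = neighbors G v \<inter> S"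
  by (auto simp: neighbors_def induced_def)

lemma card_neighbors:
  assumes "fin_graph G"
  shows "card (neighbors G v) = vdegree G v"
proof -
  have "e \<in> (\<lambda>u. {u, v}) ` neighbors G v" if e: "e \<in> edges G" "v \<in> e" for e
  proof -
    have "card e = 2"
      using assms e(1) by (auto simp: fin_graph_def pairs_def)
    then obtain u where "e = {u, v}"
      using e(2) by (auto simp: card_2_iff)
    then show ?thesis
      using e(1) by (auto simp: neighbors_def)
  qed
  then have "(\<lambda>u. {u, v}) ` neighbors G v = {e \<in> edges G. v \<in> e}"
    by (auto simp: neighbors_def)
  moreover have "inj_on (\<lambda>u. {u, v}) (neighbors G v)"
    by (rule inj_onI) (auto simp: doubleton_eq_iff)
  ultimately show ?thesis
    unfolding vdegree_def by (metis card_image)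
qed

lemma sum_vdegree:
  assumes "fin_graph G"
  shows "(\<Sum>v\<in>verts G. vdegree G v) = 2 * card (edges G)"
proof -
  have "card {v \<in> verts G. v \<in> e} = 2" if "e \<in> edges G" for e
  proof -
    have e: "e \<subseteq> verts G" "card e = 2"
      using assms that by (auto simp: fin_graph_def pairs_def)
    then have "{v \<in> verts G. v \<in> e} = e"
      by blast
    with e(2) show ?thesis
      by simp
  qed
  then show ?thesis
    unfolding vdegree_def
    using sum_multicount[OF fin_graph_finite_verts[OF assms] fin_graph_finite_edges[OF assms],
        of "\<lambda>v e. v \<in> e" 2]
    by simp
qed

lemma min_degree_attained:
  assumes "fin_graph G" "verts G \<noteq> {}"
  obtains v where "v \<in> verts G" "vdegree G v = min_degree G"
proof -
  have "min_degree G \<in> vdegree G ` verts G"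
    unfolding min_degree_def using assms by (intro Min_in) (auto simp: fin_graph_def)
  then show thesis
    using that by auto
qed

lemma card_verts_mult_min_degree_le:
  assumes "fin_graph G"
  shows "card (verts G) * min_degree G \<le> 2 * card (edges G)"
proof -
  have "card (verts G) * min_degree G \<le> (\<Sum>v\<in>verts G. vdegree G v)"
    using sum_bounded_below[of "verts G" "min_degree G" "vdegree G"] assms
    by (simp add: min_degree_def fin_graph_finite_verts)
  then show ?thesis
    using sum_vdegree[OF assms] by simp
qed

section \<open>Maxima over induced subgraphs\<close>

lemma finite_max_induced_set:
  "fin_graph G \<Longrightarrow> finite {f (induced G S) | S. S \<subseteq> verts G \<and> S \<noteq> {}}"
  by (simp add: fin_graph_finite_verts)

lemma max_induced_ge:
  assumes "fin_graph G" "S \<subseteq> verts G" "S \<noteq> {}"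
  shows "f (induced G S) \<le> max_induced f G"
  unfolding max_induced_def
  using finite_max_induced_set[OF assms(1)] assms(2,3) by (intro Max_ge) auto

lemma max_induced_attained:
  assumes "fin_graph G" "verts G \<noteq> {}"
  obtains S where "S \<subseteq> verts G" "S \<noteq> {}" "max_induced f G = f (induced G S)"
proof -
  have "max_induced f G \<in> {f (induced G S) | S. S \<subseteq> verts G \<and> S \<noteq> {}}"
    unfolding max_induced_def
    using finite_max_induced_set[OF assms(1)] assms(2) by (intro Max_in) auto
  then show thesis
    using that by auto
qed

lemma max_induced_mono:
  assumes "fin_graph G" "verts G \<noteq> {}"
    and "\<And>H. fin_graph H \<Longrightarrow> verts H \<noteq> {} \<Longrightarrow> f H \<le> g H"
  shows "max_induced f G \<le> max_induced g G"
proof -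
  obtain S where S: "S \<subseteq> verts G" "S \<noteq> {}" "max_induced f G = f (induced G S)"
    using max_induced_attained[OF assms(1,2)] .
  have "f (induced G S) \<le> g (induced G S)"
    using assms(3) fin_graph_induced[OF assms(1) S(1)] S(2) by simp
  also have "\<dots> \<le> max_induced g G"
    using max_induced_ge[OF assms(1) S(1,2)] .
  finally show ?thesis
    using S(3) by simp
qed

section \<open>Maximum average degree\<close>

definition average_degree :: "'a graph \<Rightarrow> real" where
  "average_degree G = 2 * real (card (edges G)) / real (card (verts G))"

lemma Mad_eq_Max: "Mad G = Max {average_degree H | H. subgraph H G \<and> card (verts H) \<ge> 1}"
  by (simp only: Mad_def average_degree_def)

lemma finite_Mad_set:
  "fin_graph G \<Longrightarrow> finite {average_degree H | H. subgraph H G \<and> card (verts H) \<ge> 1}"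
  by (intro finite_image_set finite_Collect_conjI disjI1 finite_subgraphs)

lemma average_degree_le_Mad:
  assumes "fin_graph G" "subgraph H G" "verts H \<noteq> {}"
  shows "average_degree H \<le> Mad G"
proof -
  have "card (verts H) \<ge> 1"
    using fin_graph_card_verts_pos[of H] assms(2,3) by (simp add: subgraph_def)
  then show ?thesis
    unfolding Mad_eq_Max
    using finite_Mad_set[OF assms(1)] assms(2) by (intro Max_ge) blast+
qed

lemma Mad_attained:
  assumes "fin_graph G" "verts G \<noteq> {}"
  obtains H where "subgraph H G" "verts H \<noteq> {}" "Mad G = average_degree H"
proof -
  have "card (verts G) \<ge> 1"
    using fin_graph_card_verts_pos[OF assms] by simp
  then have "Mad G \<in> {average_degree H | H. subgraph H G \<and> card (verts H) \<ge> 1}"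
    unfolding Mad_eq_Max
    using finite_Mad_set[OF assms(1)] subgraph_refl[OF assms(1)] by (intro Max_in) blast+
  then show thesis
    using that by fastforce
qed

lemma degeneracy_le_Mad:
  assumes "fin_graph G" "verts G \<noteq> {}"
  shows "real (degeneracy G) \<le> Mad G"
proof -
  obtain S where S: "S \<subseteq> verts G" "S \<noteq> {}" "degeneracy G = min_degree (induced G S)"
    unfolding degeneracy_def using max_induced_attained[OF assms] .
  let ?H = "induced G S"
  have H: "fin_graph ?H"
    using fin_graph_induced[OF assms(1) S(1)] .
  have "real (card S * min_degree ?H) \<le> real (2 * card (edges ?H))"
    using card_verts_mult_min_degree_le[OF H] by (simp only: of_nat_le_iff verts_induced)
  then have "real (min_degree ?H) \<le> average_degree ?H"
    using fin_graph_card_verts_pos[OF H] S(2)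
    by (simp add: average_degree_def le_divide_eq mult.commute)
  also have "\<dots> \<le> Mad G"
    using average_degree_le_Mad[OF assms(1) subgraph_induced[OF assms(1) S(1)]] S(2) by simp
  finally show ?thesis
    using S(3) by simp
qed

lemma of_nat_choose_two: "real (m choose 2) = real m * (real m - 1) / 2"
  by (cases m) (auto simp: choose_two real_of_nat_div algebra_simps)

lemma average_degree_less_of_card_edges:
  assumes "fin_graph G" "verts G \<noteq> {}" "0 \<le> t" "2 * real (card (edges G)) < t * (t + 1)"
  shows "average_degree G < t"
proof -
  let ?v = "real (card (verts G))" and ?e = "real (card (edges G))"
  have v: "?v > 0"
    using fin_graph_card_verts_pos[OF assms(1,2)] by simp
  have "2 * ?e < t * ?v"
  proof (cases "?v < t + 1")
    case True
    have "?e \<le> real (card (verts G) choose 2)"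
      using fin_graph_card_edges_le[OF assms(1)] by simp
    then have "2 * ?e \<le> (?v - 1) * ?v"
      by (simp add: of_nat_choose_two mult.commute)
    also have "\<dots> < t * ?v"
      using True v by (intro mult_strict_right_mono) auto
    finally show ?thesis .
  next
    case False
    then have "t * (t + 1) \<le> t * ?v"
      using assms(3) by (intro mult_left_mono) auto
    with assms(4) show ?thesis
      by linarith
  qed
  then show ?thesis
    using v by (simp add: average_degree_def divide_less_eq)
qed

lemma Mad_less_of_card_edges:
  assumes "fin_graph G" "verts G \<noteq> {}" "0 \<le> t" "2 * real (card (edges G)) < t * (t + 1)"
  shows "Mad G < t"
proof -
  obtain H where H: "subgraph H G" "verts H \<noteq> {}" "Mad G = average_degree H"
    using Mad_attained[OF assms(1,2)] .
  then have "card (edges H) \<le> card (edges G)"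
    using fin_graph_finite_edges[OF assms(1)] by (auto simp: subgraph_def intro: card_mono)
  then have "2 * real (card (edges H)) < t * (t + 1)"
    using assms(4) by linarith
  then show ?thesis
    using average_degree_less_of_card_edges[OF _ H(2) assms(3)] H(1,3) by (simp add: subgraph_def)
qed

lemma Mad_le_of_card_edges:
  assumes "fin_graph G" "verts G \<noteq> {}" "0 \<le> t" "2 * real (card (edges G)) \<le> t * (t + 1)"
  shows "Mad G \<le> t"
proof (rule dense_ge)
  fix u assume "t < u"
  then have "t * (t + 1) < u * (u + 1)"
    using assms(3) by (intro mult_strict_mono) auto
  then show "Mad G \<le> u"
    using Mad_less_of_card_edges[OF assms(1,2), of u] assms(3,4) \<open>t < u\<close> by simp
qed

section \<open>Cliques\<close>

lemma finite_clique_cards: "fin_graph G \<Longrightarrow> finite {card S | S. is_clique G S}"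
  by (simp add: is_clique_def fin_graph_finite_verts)

lemma clique_number_ge: "fin_graph G \<Longrightarrow> is_clique G S \<Longrightarrow> card S \<le> clique_number G"
  unfolding clique_number_def by (intro Max_ge finite_clique_cards) auto

lemma clique_number_attained:
  assumes "fin_graph G"
  obtains S where "is_clique G S" "card S = clique_number G"
proof -
  have "is_clique G {}"
    by (auto simp: is_clique_def pairs_def)
  then have "clique_number G \<in> {card S | S. is_clique G S}"
    unfolding clique_number_def using finite_clique_cards[OF assms] by (intro Max_in) auto
  then show thesis
    using that by auto
qed

lemma clique_number_pos:
  assumes "fin_graph G" "verts G \<noteq> {}"
  shows "0 < clique_number G"
proof -
  obtain v where "v \<in> verts G"
    using assms(2) by auto
  then have "is_clique G {v}"
    by (auto simp: is_clique_def pairs_def subset_singleton_iff)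
  then show ?thesis
    using clique_number_ge[OF assms(1)] by fastforce
qed

lemma clique_number_mono:
  assumes "fin_graph G" "subgraph H G"
  shows "clique_number H \<le> clique_number G"
proof -
  have "fin_graph H"
    using assms(2) by (simp add: subgraph_def)
  then obtain S where S: "is_clique H S" "card S = clique_number H"
    using clique_number_attained by metis
  then have "is_clique G S"
    using assms(2) by (auto simp: is_clique_def subgraph_def)
  then show ?thesis
    using clique_number_ge[OF assms(1)] S(2) by metis
qed

lemma clique_number_copy_of_complete_ge:
  assumes "copy_of_complete m G"
  shows "m \<le> clique_number G"
proof -
  have "fin_graph G" "is_clique G (verts G)" "card (verts G) = m"
    using assms by (auto simp: copy_of_complete_def fin_graph_def is_clique_def)
  then show ?thesis
    using clique_number_ge by blast
qed

lemma induced_clique: "fin_graph G \<Longrightarrow> is_clique G S \<Longrightarrow> induced G S = (S, pairs S)"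
  unfolding induced_def is_clique_def fin_graph_def pairs_def by auto

lemma clique_number_le_max_induced:
  assumes "fin_graph G" "verts G \<noteq> {}"
    and "\<And>S. finite S \<Longrightarrow> S \<noteq> {} \<Longrightarrow> card S \<le> f (S, pairs S) + 1"
  shows "clique_number G \<le> max_induced f G + 1"
proof -
  obtain S where S: "is_clique G S" "card S = clique_number G"
    using clique_number_attained[OF assms(1)] .
  have "S \<noteq> {}" "finite S"
    using S(2) clique_number_pos[OF assms(1,2)] by (auto intro: card_ge_0_finite)
  moreover have "S \<subseteq> verts G"
    using S(1) by (simp add: is_clique_def)
  ultimately show ?thesis
    using assms(3)[of S] max_induced_ge[OF assms(1), of S f] induced_clique[OF assms(1) S(1)] S(2)
    by simp
qed

section \<open>Connectivity\<close>

definition vertex_cut :: "'a graph \<Rightarrow> 'a set \<Rightarrow> bool" where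
  "vertex_cut G X \<longleftrightarrow> X \<subset> verts G \<and>
     (\<not> connected_graph (induced G (verts G - X)) \<or> card (verts G - X) = 1)"

definition edge_cut :: "'a graph \<Rightarrow> 'a set set \<Rightarrow> bool" where
  "edge_cut G F \<longleftrightarrow> F \<subseteq> edges G \<and> \<not> connected_graph (verts G, edges G - F)"

lemma not_connected_if_no_neighbors:
  assumes "v \<in> verts G" "w \<in> verts G" "w \<noteq> v" "neighbors G v = {}"
  shows "\<not> connected_graph G"
proof
  assume "connected_graph G"
  then have "(\<lambda>x y. {x, y} \<in> edges G)\<^sup>*\<^sup>* w v"
    using assms(1,2) by (simp add: connected_graph_def)
  then show False
    using assms(3,4) by (cases rule: rtranclp.cases) (auto simp: neighbors_def)
qed

lemma vertex_cut_neighbors: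
  assumes "fin_graph G" "v \<in> verts G"
  shows "vertex_cut G (neighbors G v)"
proof -
  let ?R = "verts G - neighbors G v"
  have v: "v \<in> ?R"
    using assms neighbors_subset by fastforce
  have "\<not> connected_graph (induced G ?R)" if "?R \<noteq> {v}"
  proof -
    obtain w where "w \<in> ?R" "w \<noteq> v"
      using v \<open>?R \<noteq> {v}\<close> by blast
    moreover have "neighbors (induced G ?R) v = {}"
      using neighbors_induced[OF v] by auto
    ultimately show ?thesis
      using v by (intro not_connected_if_no_neighbors[of v _ w]) auto
  qed
  then show ?thesis
    unfolding vertex_cut_def using neighbors_subset[OF assms(1)] assms(2) by (cases "?R = {v}") auto
qed

lemma edge_cut_incident_edges:
  assumes "v \<in> verts G" "w \<in> verts G" "w \<noteq> v"
  shows "edge_cut G {e \<in> edges G. v \<in> e}"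
  unfolding edge_cut_def
proof
  show "\<not> connected_graph (verts G, edges G - {e \<in> edges G. v \<in> e})"
    using assms by (intro not_connected_if_no_neighbors[of v _ w]) (auto simp: neighbors_def)
qed auto

lemma vertex_connectivity_eq_Min: "vertex_connectivity G = Min {card X | X. vertex_cut G X}"
  by (simp add: vertex_connectivity_def vertex_cut_def)

lemma edge_connectivity_eq_Min:
  "1 < card (verts G) \<Longrightarrow> edge_connectivity G = Min {card F | F. edge_cut G F}"
  by (simp add: edge_connectivity_def edge_cut_def)

lemma finite_vertex_cut_cards: "fin_graph G \<Longrightarrow> finite {card X | X. vertex_cut G X}"
  by (simp add: vertex_cut_def fin_graph_finite_verts psubset_eq)

lemma finite_edge_cut_cards: "fin_graph G \<Longrightarrow> finite {card F | F. edge_cut G F}"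
  by (simp add: edge_cut_def fin_graph_finite_edges)

lemma vertex_connectivity_le:
  "fin_graph G \<Longrightarrow> vertex_cut G X \<Longrightarrow> vertex_connectivity G \<le> card X"
  unfolding vertex_connectivity_eq_Min by (intro Min_le finite_vertex_cut_cards) auto

lemma vertex_connectivity_attained:
  assumes "fin_graph G" "verts G \<noteq> {}"
  obtains X where "vertex_cut G X" "card X = vertex_connectivity G"
proof -
  obtain v where "v \<in> verts G"
    using assms(2) by auto
  then have "\<exists>X. vertex_cut G X"
    using vertex_cut_neighbors[OF assms(1)] by metis
  then have "vertex_connectivity G \<in> {card X | X. vertex_cut G X}"
    unfolding vertex_connectivity_eq_Min
    using finite_vertex_cut_cards[OF assms(1)] by (intro Min_in) auto
  then show thesis
    using that by auto
qed

lemma edge_connectivity_le: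
  assumes "fin_graph G" "edge_cut G F"
  shows "edge_connectivity G \<le> card F"
proof (cases "card (verts G) \<le> 1")
  case False
  then have "edge_connectivity G = Min {card F | F. edge_cut G F}"
    by (simp add: edge_connectivity_eq_Min)
  then show ?thesis
    using finite_edge_cut_cards[OF assms(1)] assms(2) by (auto intro: Min_le)
qed (simp add: edge_connectivity_def)

lemma edge_connectivity_attained:
  assumes "fin_graph G" "1 < card (verts G)"
  obtains F where "edge_cut G F" "card F = edge_connectivity G"
proof -
  have "\<not> card (verts G) \<le> Suc 0"
    using assms(2) by simp
  then obtain v w where "v \<in> verts G" "w \<in> verts G" "w \<noteq> v"
    using card_le_Suc0_iff_eq[OF fin_graph_finite_verts[OF assms(1)]] by blast
  then have "\<exists>F. edge_cut G F"
    using edge_cut_incident_edges by metis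
  then have "edge_connectivity G \<in> {card F | F. edge_cut G F}"
    unfolding edge_connectivity_eq_Min[OF assms(2)]
    using finite_edge_cut_cards[OF assms(1)] by (intro Min_in) auto
  then show thesis
    using that by auto
qed

lemma vertex_connectivity_le_min_degree:
  assumes "fin_graph G" "verts G \<noteq> {}"
  shows "vertex_connectivity G \<le> min_degree G"
proof -
  obtain v where v: "v \<in> verts G" "vdegree G v = min_degree G"
    using min_degree_attained[OF assms] .
  have "vertex_connectivity G \<le> card (neighbors G v)"
    using vertex_connectivity_le[OF assms(1) vertex_cut_neighbors[OF assms(1) v(1)]] .
  then show ?thesis
    using card_neighbors[OF assms(1)] v(2) by simp
qed

lemma edge_connectivity_le_min_degree:
  assumes "fin_graph G" "verts G \<noteq> {}"
  shows "edge_connectivity G \<le> min_degree G"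
proof (cases "card (verts G) \<le> 1")
  case False
  obtain v where v: "v \<in> verts G" "vdegree G v = min_degree G"
    using min_degree_attained[OF assms] .
  have "verts G \<noteq> {v}"
    using False by auto
  then obtain w where "w \<in> verts G" "w \<noteq> v"
    using v(1) by auto
  then have "edge_cut G {e \<in> edges G. v \<in> e}"
    using edge_cut_incident_edges v(1) by metis
  then show ?thesis
    using edge_connectivity_le[OF assms(1)] v(2) unfolding vdegree_def by fastforce
qed (simp add: edge_connectivity_def)

lemma connected_complete: "connected_graph (S, pairs S)"
  unfolding connected_graph_def
proof (intro ballI)
  fix u v assume "u \<in> verts (S, pairs S)" "v \<in> verts (S, pairs S)"
  then show "(\<lambda>x y. {x, y} \<in> edges (S, pairs S))\<^sup>*\<^sup>* u v"
    by (cases "u = v") (auto intro: r_into_rtranclp)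
qed

lemma card_vertex_cut_complete:
  assumes "finite S" "vertex_cut (S, pairs S) X"
  shows "card S = card X + 1"
proof -
  have "induced (S, pairs S) (S - X) = (S - X, pairs (S - X))"
    by (auto simp: induced_def pairs_def)
  then have "X \<subset> S" "card (S - X) = 1"
    using assms(2) connected_complete[of "S - X"] by (simp_all add: vertex_cut_def)
  then show ?thesis
    using card_Diff_subset[of X S] card_mono[of S X] assms(1) finite_subset by fastforce
qed

lemma card_edge_cut_complete:
  assumes "finite S" "edge_cut (S, pairs S) F"
  shows "card S \<le> card F + 1"
proof -
  let ?adj = "\<lambda>x y. {x, y} \<in> pairs S - F"
  obtain u v where uv: "u \<in> S" "v \<in> S" "\<not> ?adj\<^sup>*\<^sup>* u v"
    using assms(2) by (auto simp: edge_cut_def connected_graph_def)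
  then have "u \<noteq> v"
    by auto
  \<comment> \<open>The paths of length at most 2 from \<open>u\<close> to \<open>v\<close> are edge-disjoint, and \<open>F\<close> meets each of them.\<close>
  define f where "f w = (if {u, w} \<in> F then {u, w} else {w, v})" for w
  have uv_in_F: "{u, v} \<in> F"
    using uv \<open>u \<noteq> v\<close> by (auto intro: r_into_rtranclp)
  have "f w \<in> F" if "w \<in> S - {u}" for w
  proof (rule ccontr)
    assume "f w \<notin> F"
    then have "?adj u w" "?adj w v"
      using that uv(1,2) uv_in_F by (auto simp: f_def split: if_splits)
    then have "?adj\<^sup>*\<^sup>* u v"
      by (meson converse_rtranclp_into_rtranclp r_into_rtranclp)
    then show False
      using uv(3) by simp
  qed
  then have "f ` (S - {u}) \<subseteq> F"
    by auto
  moreover have "inj_on f (S - {u})"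
    by (rule inj_onI) (use uv_in_F in \<open>auto simp: f_def doubleton_eq_iff split: if_splits\<close>)
  moreover have "finite F"
    using assms finite_pairs finite_subset by (auto simp: edge_cut_def)
  ultimately have "card (S - {u}) \<le> card F"
    by (intro card_inj_on_le)
  then show ?thesis
    using uv(1) by simp
qed

lemma vertex_connectivity_complete_ge:
  assumes "finite S" "S \<noteq> {}"
  shows "card S \<le> vertex_connectivity (S, pairs S) + 1"
proof -
  obtain X where "vertex_cut (S, pairs S) X" "card X = vertex_connectivity (S, pairs S)"
    using vertex_connectivity_attained[OF fin_graph_complete[OF assms(1)]] assms(2) by auto
  then show ?thesis
    using card_vertex_cut_complete[OF assms(1)] by simp
qed

lemma edge_connectivity_complete_ge:
  assumes "finite S"
  shows "card S \<le> edge_connectivity (S, pairs S) + 1"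
proof (cases "card S \<le> 1")
  case False
  then obtain F where "edge_cut (S, pairs S) F" "card F = edge_connectivity (S, pairs S)"
    using edge_connectivity_attained[OF fin_graph_complete[OF assms]] by auto
  then show ?thesis
    using card_edge_cut_complete[OF assms] by metis
qed simp

lemma clique_number_le_kappa_star:
  "fin_graph G \<Longrightarrow> verts G \<noteq> {} \<Longrightarrow> clique_number G \<le> kappa_star G + 1"
  unfolding kappa_star_def by (intro clique_number_le_max_induced vertex_connectivity_complete_ge)

lemma clique_number_le_lambda_star:
  "fin_graph G \<Longrightarrow> verts G \<noteq> {} \<Longrightarrow> clique_number G \<le> lambda_star G + 1"
  unfolding lambda_star_def by (intro clique_number_le_max_induced edge_connectivity_complete_ge)

lemma kappa_star_le_degeneracy:
  "fin_graph G \<Longrightarrow> verts G \<noteq> {} \<Longrightarrow> kappa_star G \<le> degeneracy G"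
  unfolding kappa_star_def degeneracy_def
  by (intro max_induced_mono vertex_connectivity_le_min_degree)

lemma lambda_star_le_degeneracy:
  "fin_graph G \<Longrightarrow> verts G \<noteq> {} \<Longrightarrow> lambda_star G \<le> degeneracy G"
  unfolding lambda_star_def degeneracy_def
  by (intro max_induced_mono edge_connectivity_le_min_degree)

lemma connectivity_parameter_bounds:
  assumes "fin_graph G" "verts G \<noteq> {}"
    and "f \<in> {kappa_star, lambda_star, degeneracy}"
  shows "clique_number G \<le> f G + 1" "f G \<le> degeneracy G"
  using assms(3) clique_number_le_kappa_star[OF assms(1,2)] kappa_star_le_degeneracy[OF assms(1,2)]
    clique_number_le_lambda_star[OF assms(1,2)] lambda_star_le_degeneracy[OF assms(1,2)]
  by auto

section \<open>Coloring parameters\<close>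

lemma proper_coloring_extend:
  assumes "proper_coloring (induced G (verts G - {v})) f" "c \<notin> f ` neighbors G v"
  shows "proper_coloring G (f(v := c))"
  unfolding proper_coloring_def
proof (intro ballI impI, elim conjE)
  fix x y assume xy: "x \<in> verts G" "y \<in> verts G" "x \<noteq> y" "{x, y} \<in> edges G"
  consider "x = v" "y \<in> neighbors G v" | "y = v" "x \<in> neighbors G v" | "x \<noteq> v" "y \<noteq> v"
    using xy(4) unfolding neighbors_def by (metis insert_commute mem_Collect_eq)
  then show "(f(v := c)) x \<noteq> (f(v := c)) y"
  proof cases
    case 3
    then have "{x, y} \<in> edges (induced G (verts G - {v}))"
      using xy by (simp add: induced_def)
    then show ?thesis
      using assms(1) 3 xy by (simp add: proper_coloring_def)
  qed (use assms(2) xy(3) in auto)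
qed

lemma choosable_of_delete_vertex:
  assumes "fin_graph G" "v \<in> verts G" "vdegree G v < c"
    and deleted: "choosable (induced G (verts G - {v})) c"
  shows "choosable G c"
  unfolding choosable_def
proof (intro allI impI)
  fix L :: "'a \<Rightarrow> nat set"
  assume L: "\<forall>u \<in> verts G. finite (L u) \<and> card (L u) = c"
  then obtain f where f: "proper_coloring (induced G (verts G - {v})) f"
    "\<forall>u \<in> verts G - {v}. f u \<in> L u"
    using deleted unfolding choosable_def by auto
  have "card (f ` neighbors G v) < card (L v)"
    using card_image_le[OF finite_neighbors[OF assms(1)], of f v] card_neighbors[OF assms(1), of v]
      assms(2,3) L by simp
  then have "\<not> L v \<subseteq> f ` neighbors G v"
    using card_mono[OF finite_imageI[OF finite_neighbors[OF assms(1)]]] by (meson not_le)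
  then obtain a where a: "a \<in> L v" "a \<notin> f ` neighbors G v"
    by blast
  then have "proper_coloring G (f(v := a))"
    using f(1) by (intro proper_coloring_extend)
  moreover have "\<forall>u \<in> verts G. (f(v := a)) u \<in> L u"
    using f(2) a(1) by simp
  ultimately show "\<exists>f. proper_coloring G f \<and> (\<forall>u \<in> verts G. f u \<in> L u)"
    by blast
qed

lemma choosable_induced:
  assumes "fin_graph G" "S \<subseteq> verts G"
  shows "choosable (induced G S) (coloring_number G)"
proof -
  have "finite S"
    using assms finite_subset fin_graph_finite_verts by blast
  then show ?thesis
    using assms(2)
  proof (induction S rule: finite_psubset_induct)
    case (psubset S)
    let ?H = "induced G S"
    show ?case
    proof (cases "S = {}")
      case False
      have H: "fin_graph ?H"
        using fin_graph_induced[OF assms(1) psubset.prems] .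
      obtain v where v: "v \<in> S" "vdegree ?H v = min_degree ?H"
        using min_degree_attained[OF H] False by auto
      have "vdegree ?H v < coloring_number G"
        unfolding coloring_number_def degeneracy_def v(2)
        using max_induced_ge[OF assms(1) psubset.prems False] by (simp add: less_Suc_eq_le)
      moreover have "choosable (induced G (S - {v})) (coloring_number G)"
        using psubset.IH[of "S - {v}"] psubset.prems v(1) by auto
      ultimately show ?thesis
        using v(1) by (intro choosable_of_delete_vertex[OF H]) (simp_all add: induced_induced)
    qed (simp add: choosable_def proper_coloring_def)
  qed
qed

lemma choosable_coloring_number: "fin_graph G \<Longrightarrow> choosable G (coloring_number G)"
  using choosable_induced[of G "verts G"] by (simp add: induced_verts)

lemma choice_number_le_coloring_number:
  "fin_graph G \<Longrightarrow> choice_number G \<le> coloring_number G"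
  unfolding choice_number_def by (intro Least_le choosable_coloring_number)

lemma choosable_choice_number: "fin_graph G \<Longrightarrow> choosable G (choice_number G)"
  unfolding choice_number_def by (rule LeastI, rule choosable_coloring_number)

lemma choosable_imp_colorable:
  assumes "choosable G c"
  shows "\<exists>f. proper_coloring G f \<and> (\<forall>v \<in> verts G. f v < c)"
  using assms[unfolded choosable_def, rule_format, of "\<lambda>_. {..<c}"] by auto

lemma chromatic_number_le_choice_number:
  "fin_graph G \<Longrightarrow> chromatic_number G \<le> choice_number G"
  unfolding chromatic_number_def
  by (intro Least_le choosable_imp_colorable choosable_choice_number)

lemma chromatic_number_attained:
  assumes "fin_graph G"
  obtains f where "proper_coloring G f" "\<forall>v \<in> verts G. f v < chromatic_number G"
proof -
  have "\<exists>f. proper_coloring G f \<and> (\<forall>v \<in> verts G. f v < chromatic_number G)"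
    unfolding chromatic_number_def
    using choosable_imp_colorable[OF choosable_choice_number[OF assms]] by (rule LeastI)
  then show thesis
    using that by blast
qed

lemma clique_number_le_chromatic_number:
  assumes "fin_graph G"
  shows "clique_number G \<le> chromatic_number G"
proof -
  obtain f where f: "proper_coloring G f" "\<forall>v \<in> verts G. f v < chromatic_number G"
    using chromatic_number_attained[OF assms] .
  obtain S where S: "is_clique G S" "card S = clique_number G"
    using clique_number_attained[OF assms] .
  have "inj_on f S"
  proof (rule inj_onI, rule ccontr)
    fix x y assume xy: "x \<in> S" "y \<in> S" "f x = f y" "x \<noteq> y"
    then have "{x, y} \<in> pairs S"
      by simp
    then have "x \<in> verts G" "y \<in> verts G" "{x, y} \<in> edges G"
      using S(1) xy(1,2) unfolding is_clique_def by blast+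
    then show False
      using f(1) xy(3,4) by (simp add: proper_coloring_def)
  qed
  moreover have "f ` S \<subseteq> {..<chromatic_number G}"
    using f(2) S(1) by (auto simp: is_clique_def)
  ultimately show ?thesis
    using card_inj_on_le[of f S "{..<chromatic_number G}"] S(2) by simp
qed

lemma coloring_parameter_bounds:
  assumes "fin_graph G"
    and "f \<in> {clique_number, chromatic_number, choice_number, coloring_number}"
  shows "clique_number G \<le> f G" "f G \<le> coloring_number G"
  using assms(2) clique_number_le_chromatic_number[OF assms(1)]
    chromatic_number_le_choice_number[OF assms(1)] choice_number_le_coloring_number[OF assms(1)]
  by auto

section \<open>Edge partitions\<close>

lemma edge_partition_exists:
  assumes "0 < k"
  shows "\<exists>G. edge_partition k n G"
proof
  show "edge_partition k n (\<lambda>i. ({..<n}, if i = 0 then pairs {..<n} else {}))"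
    using assms by (auto simp: edge_partition_def disjoint_family_on_def complete_graph_def)
qed

lemma edge_partition_fin_graph: "edge_partition k n G \<Longrightarrow> i < k \<Longrightarrow> fin_graph (G i)"
  by (auto simp: edge_partition_def fin_graph_def complete_graph_def)

lemma edge_partition_verts_nonempty:
  "edge_partition k n G \<Longrightarrow> i < k \<Longrightarrow> 0 < n \<Longrightarrow> verts (G i) \<noteq> {}"
  by (auto simp: edge_partition_def lessThan_empty_iff)

lemma finite_param_sums: "finite {(\<Sum>i<k. f (G i)) | G. edge_partition k n G}"
proof -
  \<comment> \<open>\<open>edge_partition\<close> leaves \<open>G i\<close> free for \<open>i \<ge> k\<close>, hence the restriction to \<open>{..<k}\<close>.\<close>
  let ?P = "{..<k} \<rightarrow>\<^sub>E {{..<n}} \<times> Pow (pairs {..<n})"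
  have finite_P: "finite ?P"
    by (intro finite_PiE) (auto simp: finite_pairs)
  have "(\<Sum>i<k. f (G i)) \<in> (\<lambda>G. \<Sum>i<k. f (G i)) ` ?P" if "edge_partition k n G" for G
  proof
    show "(\<Sum>i<k. f (G i)) = (\<Sum>i<k. f (restrict G {..<k} i))"
      by simp
    show "restrict G {..<k} \<in> ?P"
      using that by (auto simp: PiE_iff mem_Times_iff edge_partition_def complete_graph_def)
  qed
  then have "{(\<Sum>i<k. f (G i)) | G. edge_partition k n G} \<subseteq> (\<lambda>G. \<Sum>i<k. f (G i)) ` ?P"
    by blast
  with finite_P show ?thesis
    by (rule finite_surj)
qed

lemma param_max_ge: "edge_partition k n G \<Longrightarrow> (\<Sum>i<k. f (G i)) \<le> param_max f k n"
  unfolding param_max_def by (intro Max_ge finite_param_sums) auto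

lemma param_max_attained:
  assumes "0 < k"
  obtains G where "edge_partition k n G" "param_max f k n = (\<Sum>i<k. f (G i))"
proof -
  have "param_max f k n \<in> {(\<Sum>i<k. f (G i)) | G. edge_partition k n G}"
    unfolding param_max_def
    using edge_partition_exists[OF assms] by (intro Max_in finite_param_sums) auto
  then show thesis
    using that by auto
qed

lemma of_nat_param_max:
  assumes "0 < k"
  shows "real (param_max f k n) = param_max (\<lambda>G. real (f G)) k n"
proof (rule antisym)
  obtain G where G: "edge_partition k n G" "param_max f k n = (\<Sum>i<k. f (G i))"
    using param_max_attained[OF assms] .
  then show "real (param_max f k n) \<le> param_max (\<lambda>G. real (f G)) k n"
    using param_max_ge[OF G(1), of "\<lambda>G. real (f G)"] by simp
  obtain H where H: "edge_partition k n H"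
    "param_max (\<lambda>G. real (f G)) k n = (\<Sum>i<k. real (f (H i)))"
    using param_max_attained[OF assms] .
  have "real (\<Sum>i<k. f (H i)) \<le> real (param_max f k n)"
    using param_max_ge[OF H(1)] by (simp only: of_nat_le_iff)
  then show "param_max (\<lambda>G. real (f G)) k n \<le> real (param_max f k n)"
    using H(2) by simp
qed

lemma param_max_mono_add:
  fixes f g :: "nat graph \<Rightarrow> real"
  assumes "0 < k" "0 < n"
    and "\<And>G. fin_graph G \<Longrightarrow> verts G \<noteq> {} \<Longrightarrow> f G \<le> g G + c"
  shows "param_max f k n \<le> param_max g k n + real k * c"
proof -
  obtain G where G: "edge_partition k n G" "param_max f k n = (\<Sum>i<k. f (G i))"
    using param_max_attained[OF assms(1)] .
  have "(\<Sum>i<k. f (G i)) \<le> (\<Sum>i<k. g (G i) + c)"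
    using edge_partition_fin_graph[OF G(1)] edge_partition_verts_nonempty[OF G(1) _ assms(2)]
    by (intro sum_mono assms(3)) auto
  also have "\<dots> = (\<Sum>i<k. g (G i)) + real k * c"
    by (simp add: sum.distrib)
  also have "\<dots> \<le> param_max g k n + real k * c"
    using param_max_ge[OF G(1)] by simp
  finally show ?thesis
    using G(2) by simp
qed

lemma param_max_eq_floor_Mad:
  fixes f :: "nat graph \<Rightarrow> nat"
  assumes "0 < k" "0 < n"
    and Mad_less: "param_max Mad k n + real k < real (param_max clique_number k n) + 1"
    and clique_number_le:
      "\<And>G. fin_graph G \<Longrightarrow> verts G \<noteq> {} \<Longrightarrow> clique_number G + c \<le> f G + 1"
    and le_degeneracy:
      "\<And>G. fin_graph G \<Longrightarrow> verts G \<noteq> {} \<Longrightarrow> f G \<le> degeneracy G + c"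
  shows "int (param_max f k n) = \<lfloor>param_max Mad k n\<rfloor> + int (k * c)"
proof -
  have "real (param_max clique_number k n) \<le> real (param_max f k n) + real k * (1 - real c)"
    unfolding of_nat_param_max[OF assms(1)]
  proof (rule param_max_mono_add[OF assms(1,2)])
    fix G :: "nat graph" assume "fin_graph G" "verts G \<noteq> {}"
    then show "real (clique_number G) \<le> real (f G) + (1 - real c)"
      using clique_number_le[of G] by linarith
  qed
  moreover have "real (param_max f k n) \<le> param_max Mad k n + real k * real c"
    unfolding of_nat_param_max[OF assms(1)]
  proof (rule param_max_mono_add[OF assms(1,2)])
    fix G :: "nat graph" assume "fin_graph G" "verts G \<noteq> {}"
    then show "real (f G) \<le> Mad G + real c"
      using le_degeneracy[of G] degeneracy_le_Mad[of G] by linarith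
  qed
  ultimately have "\<lfloor>param_max Mad k n\<rfloor> = int (param_max f k n) - int (k * c)"
    using Mad_less by (intro floor_unique) (simp_all add: algebra_simps)
  then show ?thesis
    by simp
qed

section \<open>Packings\<close>

lemma Mad_add_one_le_clique_number_of_copy:
  assumes "fin_graph G" "verts G \<noteq> {}" "copy_of_complete m (drop_isolated G)"
  shows "Mad G + 1 \<le> clique_number G"
proof -
  let ?\<omega> = "clique_number G"
  have "card (edges G) = m choose 2"
    using assms(3) unfolding copy_of_complete_def by (metis card_pairs edges_drop_isolated)
  also have "\<dots> \<le> ?\<omega> choose 2"
    using clique_number_copy_of_complete_ge[OF assms(3)]
      clique_number_mono[OF assms(1) subgraph_drop_isolated[OF assms(1)]]
    by (intro binomial_right_mono) simp
  finally have "real (card (edges G)) \<le> real (?\<omega> choose 2)"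
    by simp
  then have "2 * real (card (edges G)) \<le> (real ?\<omega> - 1) * (real ?\<omega> - 1 + 1)"
    by (simp add: of_nat_choose_two mult.commute)
  then have "Mad G \<le> real ?\<omega> - 1"
    using clique_number_pos[OF assms(1,2)] by (intro Mad_le_of_card_edges[OF assms(1,2)]) auto
  then show ?thesis
    by simp
qed

lemma clique_number_F_family_ge:
  assumes "G \<in> F_family p r"
    and "real r \<ge> (real p - 1) / 2 \<Longrightarrow> clique_number G = p"
  shows "p \<le> clique_number G"
proof (cases "real r < (real p - 1) / 2")
  case True
  then obtain H where "fin_graph G" "subgraph H G" "copy_of_complete p H"
    using assms(1) by (auto simp: F_family_def contains_complete_def)
  then show ?thesis
    using clique_number_copy_of_complete_ge clique_number_mono by (metis order.trans)
qed (use assms(2) in simp)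

lemma Mad_less_clique_number_of_F_family:
  assumes "fin_graph G" "verts G \<noteq> {}" "drop_isolated G \<in> F_family p r" "r < p"
    and "real r \<ge> (real p - 1) / 2 \<Longrightarrow> clique_number (drop_isolated G) = p"
  shows "Mad G < clique_number G"
proof -
  have "card (edges G) = (p choose 2) + r"
    using assms(3) by (simp add: F_family_def)
  then have "2 * real (card (edges G)) < real p * (real p + 1)"
    using assms(4) by (simp add: of_nat_choose_two field_simps)
  then have "Mad G < real p"
    by (intro Mad_less_of_card_edges[OF assms(1,2)]) auto
  also have "p \<le> clique_number (drop_isolated G)"
    using clique_number_F_family_ge[OF assms(3,5)] .
  also have "\<dots> \<le> clique_number G"
    using clique_number_mono[OF assms(1) subgraph_drop_isolated[OF assms(1)]] .
  finally show ?thesis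
    by simp
qed

lemma sum_Mad_less_param_max_clique_number:
  assumes G: "edge_partition k n G" and "0 < n" and "j < k"
    and "Mad (G j) < clique_number (G j)"
    and copies: "\<And>i. i < k \<Longrightarrow> i \<noteq> j \<Longrightarrow> \<exists>m. copy_of_complete m (drop_isolated (G i))"
  shows "(\<Sum>i<k. Mad (G i)) + real k < real (param_max clique_number k n) + 1"
proof -
  have "Mad (G i) + 1 \<le> clique_number (G i)" if "i \<in> {..<k} - {j}" for i
    using Mad_add_one_le_clique_number_of_copy edge_partition_fin_graph[OF G]
      edge_partition_verts_nonempty[OF G _ assms(2)] copies that by blast
  then have "(\<Sum>i\<in>{..<k} - {j}. Mad (G i) + 1) \<le> (\<Sum>i\<in>{..<k} - {j}. real (clique_number (G i)))"
    by (intro sum_mono)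
  moreover have "Mad (G j) + 1 < real (clique_number (G j)) + 1"
    using assms(4) by simp
  ultimately have "(\<Sum>i<k. Mad (G i) + 1) < real (\<Sum>i<k. clique_number (G i)) + 1"
    using assms(3) by (simp add: sum.remove[of "{..<k}" j])
  also have "\<dots> \<le> real (param_max clique_number k n) + 1"
    using param_max_ge[OF G, of clique_number] by (simp del: of_nat_sum)
  finally show ?thesis
    by (simp add: sum.distrib)
qed

lemma type1_packing_sum_Mad_less:
  assumes "type1_packing k n p q r G" "0 < n" "0 < k"
  shows "(\<Sum>i<k. Mad (G i)) + real k < real (param_max clique_number k n) + 1"
proof -
  have G: "edge_partition k n G"
    using assms(1) by (simp add: type1_packing_def)
  have copies: "\<exists>m. copy_of_complete m (drop_isolated (G i))" if "i < k" for i
    using assms(1) that unfolding type1_packing_def by blast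
  obtain m where "copy_of_complete m (drop_isolated (G 0))"
    using copies[OF assms(3)] by blast
  then have "Mad (G 0) + 1 \<le> clique_number (G 0)"
    using edge_partition_fin_graph[OF G assms(3)] edge_partition_verts_nonempty[OF G assms(3,2)]
    by (intro Mad_add_one_le_clique_number_of_copy)
  then show ?thesis
    using sum_Mad_less_param_max_clique_number[OF G assms(2,3)] copies by simp
qed

lemma type2_packing_sum_Mad_less:
  assumes "type2_packing k n p q r G j" "0 < n"
    and "real r \<ge> (real p - 1) / 2 \<Longrightarrow> clique_number (drop_isolated (G j)) = p"
  shows "(\<Sum>i<k. Mad (G i)) + real k < real (param_max clique_number k n) + 1"
proof -
  have G: "edge_partition k n G" and j: "j < k"
    and exceptional: "drop_isolated (G j) \<in> F_family p r" "r < p"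
    using assms(1) unfolding type2_packing_def by blast+
  have copies: "\<exists>m. copy_of_complete m (drop_isolated (G i))" if "i < k" "i \<noteq> j" for i
    using assms(1) that unfolding type2_packing_def by blast
  have "Mad (G j) < clique_number (G j)"
    using edge_partition_fin_graph[OF G j] edge_partition_verts_nonempty[OF G j assms(2)]
      exceptional assms(3) by (rule Mad_less_clique_number_of_F_family)
  then show ?thesis
    using sum_Mad_less_param_max_clique_number[OF G assms(2) j] copies by blast
qed

theorem theorem7p3:
  fixes n k p q r :: nat
  assumes "n \<ge> 3" and "2 \<le> k" and "k \<le> n choose 2"
    and "k * (p choose 2) \<le> n choose 2" and "n choose 2 < k * ((p + 1) choose 2)"
    and "n choose 2 = k * (p choose 2) + q * p + r"
    and "q < k" and "r < p"
    and attained: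
      "(\<exists>G. type1_packing k n p q r G \<and> (\<Sum>i<k. Mad (G i)) = param_max Mad k n) \<or>
       (\<exists>G j. type2_packing k n p q r G j \<and> (\<Sum>i<k. Mad (G i)) = param_max Mad k n \<and>
              (real r \<ge> (real p - 1) / 2 \<longrightarrow> clique_number (drop_isolated (G j)) = p))"
  shows "(param_max clique_number k n = param_max chromatic_number k n \<and>
          param_max chromatic_number k n = param_max choice_number k n \<and>
          param_max choice_number k n = param_max coloring_number k n \<and>
          int (param_max coloring_number k n) = \<lfloor>param_max Mad k n\<rfloor> + int k) \<and>
         (param_max kappa_star k n = param_max lambda_star k n \<and>
          param_max lambda_star k n = param_max degeneracy k n \<and>
          int (param_max degeneracy k n) = \<lfloor>param_max Mad k n\<rfloor>)"
proof -
  have pos: "0 < k" "0 < n"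
    using assms(1,2) by simp_all
  have "param_max Mad k n + real k < real (param_max clique_number k n) + 1"
    using attained type1_packing_sum_Mad_less type2_packing_sum_Mad_less pos by metis
  note eq_floor = param_max_eq_floor_Mad[OF pos this]
  have "int (param_max f k n) = \<lfloor>param_max Mad k n\<rfloor> + int k"
    if "f \<in> {clique_number, chromatic_number, choice_number, coloring_number}" for f
    using eq_floor[of 1 f] coloring_parameter_bounds[OF _ that] by (simp add: coloring_number_def)
  moreover have "int (param_max f k n) = \<lfloor>param_max Mad k n\<rfloor>"
    if "f \<in> {kappa_star, lambda_star, degeneracy}" for f
    using eq_floor[of 0 f] connectivity_parameter_bounds[OF _ _ that] by simp
  ultimately show ?thesis
    by (metis insertI1 insertI2 of_nat_eq_iff)
qed

end
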